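(* Let $G$ be a graph on vertices $1,\dots,n$ containing a pair of twin vertices $x$ and $y$ (adjacent or non-adjacent) with $\deg(x)=\deg(y)=d$, and let $(\lambda,\mathbf{v},\mathbf{u})$ be a generalized eigenpair for the matrix $K(G)$ with $\lambda\neq0$. (1) Suppose $x,y$ are non-adjacent. If $\lambda=\pm\sqrt{1-d}$, then $\mathbf{v}_x=\mathbf{v}_y$; and if $\lambda\notin\{\sqrt{1-d},-\sqrt{1-d}\}$, then $\mathbf{u}_x=\mathbf{u}_y$. (2) Suppose $x,y$ are adjacent. If $\lambda=-\frac12\pm\frac{\sqrt{5-4d}}{2}$, then $\mathbf{v}_x=\mathbf{v}_y$; and if $\lambda\notin\left\{-\frac12+\frac{\sqrt{5-4d}}{2},-\frac12-\frac{\sqrt{5-4d}}{2}\right\}$, then $\mathbf{u}_x=\mathbf{u}_y$.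
   Context: All graphs are finite, simple and connected. With $A$ the adjacency matrix and $D$ the diagonal degree matrix of $G$, $K(G)$ is the $2n\times2n$ matrix $\begin{bmatrix} A & D-I_n\\ -I_n & 0\end{bmatrix}$. A generalized eigenpair $(\lambda,\mathbf{v},\mathbf{u})$ for $K$ consists of $\lambda\in\mathbb{C}$, an eigenvector $\mathbf{v}\in\mathbb{C}^{2n}$ of $K$ for $\lambda$ (so $\mathbf{v}\ne0$, $K\mathbf{v}=\lambda\mathbf{v}$), and $\mathbf{u}\in\mathbb{C}^{2n}$ with $K\mathbf{u}=\lambda\mathbf{u}+\mathbf{v}$. Two distinct vertices $x,y$ of $G$ are twins if they have the same neighbors among the vertices other than $x$ and $y$; they are adjacent twins if in addition $x$ and $y$ are adjacent, and non-adjacent twins otherwise. Square roots of negative numbers are complex square roots. *)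

theory Defs
  imports
    Complex_Main
    "Jordan_Normal_Form.Char_Poly"
    "Graph_Theory.Digraph_Component"
begin

(* A finite simple graph is a pair_graph, i.e. a finite, loop-free, symmetric digraph without
   parallel arcs: an undirected edge xy is represented by the two arcs (x, y) and (y, x).
   The n vertices are 0, ..., n - 1, so that they coincide with the 0-based matrix and
   vector indices of Jordan_Normal_Form. *)

(* By symmetry of the arc relation, the out-degree is the number of neighbours. *)
definition vdegree :: "'a pair_pre_digraph \<Rightarrow> 'a \<Rightarrow> nat" where
  "vdegree G x = out_degree (with_proj G) x"

definition adjacency_mat :: "nat \<Rightarrow> nat pair_pre_digraph \<Rightarrow> complex mat" where
  "adjacency_mat n G = mat n n (\<lambda>(i, j). if (i, j) \<in> parcs G then 1 else 0)"

definition degree_mat :: "nat \<Rightarrow> nat pair_pre_digraph \<Rightarrow> complex mat" where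
  "degree_mat n G = mat_diag n (\<lambda>i. of_nat (vdegree G i))"

definition K_mat :: "nat \<Rightarrow> nat pair_pre_digraph \<Rightarrow> complex mat" where
  "K_mat n G = four_block_mat
     (adjacency_mat n G) (degree_mat n G - 1\<^sub>m n)
     (- 1\<^sub>m n)           (0\<^sub>m n n)"

definition generalized_eigenpair ::
    "complex mat \<Rightarrow> complex \<Rightarrow> complex vec \<Rightarrow> complex vec \<Rightarrow> bool" where
  "generalized_eigenpair M l v u \<longleftrightarrow>
     eigenvector M v l \<and> u \<in> carrier_vec (dim_row M) \<and> M *\<^sub>v u = l \<cdot>\<^sub>v u + v"

definition twins :: "'a pair_pre_digraph \<Rightarrow> 'a \<Rightarrow> 'a \<Rightarrow> bool" where
  "twins G x y \<longleftrightarrow> x \<in> pverts G \<and> y \<in> pverts G \<and> x \<noteq> y \<and>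
     (\<forall>z \<in> pverts G - {x, y}. (x, z) \<in> parcs G \<longleftrightarrow> (y, z) \<in> parcs G)"

definition adjacent_twins :: "'a pair_pre_digraph \<Rightarrow> 'a \<Rightarrow> 'a \<Rightarrow> bool" where
  "adjacent_twins G x y \<longleftrightarrow> twins G x y \<and> (x, y) \<in> parcs G"

definition nonadjacent_twins :: "'a pair_pre_digraph \<Rightarrow> 'a \<Rightarrow> 'a \<Rightarrow> bool" where
  "nonadjacent_twins G x y \<longleftrightarrow> twins G x y \<and> (x, y) \<notin> parcs G"

end

theory Submission
  imports Defs
begin

text \<open>
  Subtracting the rows of the eigenvalue equations at \<open>x\<close> and at \<open>y\<close> leaves a problem about
  a two-by-two matrix, because all other vertices cancel. Let \<open>\<delta>\<close>, \<open>\<delta>'\<close> be the differences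
  between the entries at \<open>x\<close> and at \<open>y\<close> in the upper and lower half of \<open>v\<close>, and \<open>\<mu>\<close>, \<open>\<mu>'\<close>
  those of \<open>u\<close>. Twins see the same vertices apart from themselves and each other, so in the
  difference of their rows the adjacency block multiplies \<open>\<delta>\<close> by \<open>\<epsilon> = 0\<close> (non-adjacent) or
  \<open>\<epsilon> = - 1\<close> (adjacent): this is \<open>twins_neighbour_sum_diff\<close>. As the degrees agree, \<open>K\<close> acts on
  pairs of differences as the matrix with rows \<open>(\<epsilon>, d - 1)\<close> and \<open>(- 1, 0)\<close>
  (\<open>K_mat_twin_differences\<close>). Its characteristic polynomial is
  \<open>p(z) = z\<^sup>2 - \<epsilon> z + (d - 1)\<close>, and the square-root expressions in the theorem are the roots
  of \<open>p\<close>.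

  If \<open>p(\<lambda>) \<noteq> 0\<close>, then \<open>K - \<lambda>\<close> is injective on differences, which kills first \<open>\<delta>\<close> and
  then \<open>\<mu>\<close>. If \<open>p(\<lambda>) = 0\<close> and \<open>\<delta> \<noteq> 0\<close>, then the two pairs of differences form a Jordan
  chain of length two, so \<open>\<lambda>\<close> is a double root and \<open>\<lambda> = \<epsilon> / 2\<close>; both conclusions are in
  \<open>Jordan_chain_of_companion\<close>. In the non-adjacent case a double root contradicts \<open>\<lambda> \<noteq> 0\<close>; in
  the adjacent case \<open>\<lambda> = - 1/2\<close> is a root only if \<open>4 d = 5\<close>, which no natural number satisfies.
\<close>

lemma K_mat_mult_vec_upper:
  assumes "w \<in> carrier_vec (n + n)" "i < n"
  shows "(K_mat n G *\<^sub>v w) $ i =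
    (\<Sum>j<n. (if (i, j) \<in> parcs G then w $ j else 0)) + (of_nat (vdegree G i) - 1) * w $ (n + i)"
proof -
  have "(K_mat n G *\<^sub>v w) $ i = (\<Sum>j = 0..<n + n. K_mat n G $$ (i, j) * w $ j)"
    using assms by (simp add: K_mat_def scalar_prod_def adjacency_mat_def degree_mat_def)
  also have "\<dots> = (\<Sum>j = 0..<n. K_mat n G $$ (i, j) * w $ j) +
                 (\<Sum>j = 0..<n. K_mat n G $$ (i, n + j) * w $ (n + j))"
    using sum.atLeastLessThan_concat[of 0 n "n + n" "\<lambda>j. K_mat n G $$ (i, j) * w $ j"]
      sum.shift_bounds_nat_ivl[of "\<lambda>j. K_mat n G $$ (i, j) * w $ j" 0 n n]
    by (simp add: add.commute)
  also have "(\<Sum>j = 0..<n. K_mat n G $$ (i, j) * w $ j) =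
             (\<Sum>j<n. (if (i, j) \<in> parcs G then w $ j else 0))"
    using assms by (intro sum.cong)
      (auto simp: K_mat_def adjacency_mat_def degree_mat_def)
  also have "(\<Sum>j = 0..<n. K_mat n G $$ (i, n + j) * w $ (n + j)) =
             (\<Sum>j = 0..<n. if i = j then (of_nat (vdegree G i) - 1) * w $ (n + j) else 0)"
    using assms by (intro sum.cong)
      (auto simp: K_mat_def adjacency_mat_def degree_mat_def mat_diag_def)
  finally show ?thesis
    using assms by simp
qed

lemma K_mat_mult_vec_lower:
  assumes "w \<in> carrier_vec (n + n)" "i < n"
  shows "(K_mat n G *\<^sub>v w) $ (n + i) = - w $ i"
proof -
  have "(K_mat n G *\<^sub>v w) $ (n + i) = (\<Sum>j = 0..<n + n. K_mat n G $$ (n + i, j) * w $ j)"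
    using assms by (simp add: K_mat_def scalar_prod_def adjacency_mat_def degree_mat_def)
  also have "\<dots> = (\<Sum>j = 0..<n + n. if i = j then - w $ j else 0)"
    using assms by (intro sum.cong)
      (auto simp: K_mat_def adjacency_mat_def degree_mat_def)
  finally show ?thesis
    using assms by simp
qed

text \<open>
  The two sums agree term by term outside \<open>{x, y}\<close>. Since there are no loops, what is left of
  the one at \<open>x\<close> is the term \<open>f y\<close>, and of the one at \<open>y\<close> the term \<open>f x\<close>, both present exactly
  when the twins are adjacent.
\<close>

lemma twins_neighbour_sum_diff:
  fixes f :: "nat \<Rightarrow> 'b :: comm_ring_1"
  assumes "pair_graph G" "pverts G = {0..<n}" "twins G x y"
  shows "(\<Sum>j<n. if (x, j) \<in> parcs G then f j else 0) -
         (\<Sum>j<n. if (y, j) \<in> parcs G then f j else 0) =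
         (if (x, y) \<in> parcs G then - 1 else 0) * (f x - f y)"
proof -
  interpret pair_graph G by fact
  have xy: "x < n" "y < n" "x \<noteq> y"
    and same: "\<And>z. z < n \<Longrightarrow> z \<noteq> x \<Longrightarrow> z \<noteq> y \<Longrightarrow> (x, z) \<in> parcs G \<longleftrightarrow> (y, z) \<in> parcs G"
    using assms by (auto simp: twins_def)
  have loop: "(z, z) \<notin> parcs G" for z
    using no_loops by fastforce
  have sym: "(y, x) \<in> parcs G \<longleftrightarrow> (x, y) \<in> parcs G"
    using arcs_symmetric by blast
  let ?s = "\<lambda>z j. if (z, j) \<in> parcs G then f j else 0"
  have "sum (?s x) {..<n} - sum (?s y) {..<n} = (\<Sum>j<n. ?s x j - ?s y j)"
    by (simp add: sum_subtractf)
  also have "\<dots> = (\<Sum>j\<in>{x, y}. ?s x j - ?s y j)"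
    using xy same by (intro sum.mono_neutral_right) auto
  also have "\<dots> = (if (x, y) \<in> parcs G then - 1 else 0) * (f x - f y)"
    using xy loop sym by auto
  finally show ?thesis .
qed

text \<open>
  Allowing a remainder \<open>r\<close> covers both equations of a generalized eigenpair \<open>(l, v, u)\<close>:
  \<open>w = v\<close> with \<open>r = 0\<close>, and \<open>w = u\<close> with \<open>r = v\<close>.
\<close>

lemma K_mat_twin_differences:
  assumes G: "pair_graph G" "pverts G = {0..<n}" "twins G x y"
    and deg: "vdegree G x = d" "vdegree G y = d"
    and w: "w \<in> carrier_vec (n + n)" and r: "r \<in> carrier_vec (n + n)"
    and K: "K_mat n G *\<^sub>v w = l \<cdot>\<^sub>v w + r"
  shows "(if (x, y) \<in> parcs G then - 1 else 0) * (w $ x - w $ y)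
           + (of_nat d - 1) * (w $ (n + x) - w $ (n + y))
         = l * (w $ x - w $ y) + (r $ x - r $ y)"
    and "- (w $ x - w $ y) = l * (w $ (n + x) - w $ (n + y)) + (r $ (n + x) - r $ (n + y))"
proof -
  have xy: "x < n" "y < n"
    using G by (auto simp: twins_def)
  have row: "(K_mat n G *\<^sub>v w) $ i = l * w $ i + r $ i" if "i < n + n" for i
    using that w r by (simp add: K)
  show "(if (x, y) \<in> parcs G then - 1 else 0) * (w $ x - w $ y)
           + (of_nat d - 1) * (w $ (n + x) - w $ (n + y))
         = l * (w $ x - w $ y) + (r $ x - r $ y)"
    using row[of x] row[of y] K_mat_mult_vec_upper[OF w xy(1), of G]
      K_mat_mult_vec_upper[OF w xy(2), of G] xy deg
    unfolding twins_neighbour_sum_diff[OF G, of "\<lambda>j. w $ j", symmetric]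
    by (simp add: algebra_simps)
  show "- (w $ x - w $ y) = l * (w $ (n + x) - w $ (n + y)) + (r $ (n + x) - r $ (n + y))"
  proof -
    have "- w $ i = l * w $ (n + i) + r $ (n + i)" if "i < n" for i
      using row[of "n + i"] K_mat_mult_vec_lower[OF w that, of G] that by simp
    from this[OF xy(1)] this[OF xy(2)] show ?thesis
      by (metis (no_types, opaque_lifting) add_diff_add minus_diff_minus right_diff_distrib)
  qed
qed

text \<open>
  Eliminating the lower differences gives \<open>p(l) \<delta> = 0\<close> and
  \<open>l p(l) \<mu> = (c - l\<^sup>2) \<delta>\<close> for \<open>p(l) = l\<^sup>2 - e l + c\<close>. If \<open>p(l) = 0\<close>, a nonzero \<open>\<delta>\<close> forces
  \<open>l\<^sup>2 = c\<close>, so that \<open>p(l) = 2 l\<^sup>2 - e l\<close>, and \<open>2 l = e\<close>: the root is double.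
\<close>

lemma Jordan_chain_of_companion:
  fixes l e c \<delta> \<delta>' \<mu> \<mu>' :: "'a :: field"
  assumes v: "e * \<delta> + c * \<delta>' = l * \<delta>" "- \<delta> = l * \<delta>'"
    and u: "e * \<mu> + c * \<mu>' = l * \<mu> + \<delta>" "- \<mu> = l * \<mu>' + \<delta>'"
    and "l \<noteq> 0"
  shows "l\<^sup>2 - e * l + c \<noteq> 0 \<Longrightarrow> \<mu> = 0"
    and "l\<^sup>2 - e * l + c = 0 \<Longrightarrow> 2 * l \<noteq> e \<Longrightarrow> \<delta> = 0"
proof -
  have \<delta>: "(l\<^sup>2 - e * l + c) * \<delta> = 0"
  proof -
    (* The brackets are the differences of the two sides of the hypotheses on v. *)
    have "(l\<^sup>2 - e * l + c) * \<delta> = l * (l * \<delta> - (e * \<delta> + c * \<delta>')) + c * (l * \<delta>' - (- \<delta>))"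
      by (simp add: power2_eq_square algebra_simps)
    then show ?thesis
      unfolding v by simp
  qed
  have \<mu>: "l * (l\<^sup>2 - e * l + c) * \<mu> = (c - l\<^sup>2) * \<delta>"
  proof -
    have "l * (l\<^sup>2 - e * l + c) * \<mu> = l * (l * (l * \<mu> + \<delta> - (e * \<mu> + c * \<mu>'))
        + c * (l * \<mu>' + \<delta>' - (- \<mu>))) - c * (l * \<delta>' - (- \<delta>)) + (c - l\<^sup>2) * \<delta>"
      by (simp add: power2_eq_square algebra_simps)
    then show ?thesis
      unfolding u v(2) by simp
  qed
  show "\<mu> = 0" if "l\<^sup>2 - e * l + c \<noteq> 0"
    using \<delta> \<mu> that \<open>l \<noteq> 0\<close> by simp
  show "\<delta> = 0" if root: "l\<^sup>2 - e * l + c = 0" and "2 * l \<noteq> e"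
  proof (rule ccontr)
    assume "\<delta> \<noteq> 0"
    then have "c = l\<^sup>2"
      using \<mu> root by simp
    moreover have "l * (2 * l - e) = (l\<^sup>2 - e * l + c) - (c - l\<^sup>2)"
      by (simp add: power2_eq_square algebra_simps)
    ultimately have "l * (2 * l - e) = 0"
      unfolding root by simp
    then show False
      using \<open>l \<noteq> 0\<close> \<open>2 * l \<noteq> e\<close> by simp
  qed
qed

lemma sq_eq_iff_csqrt: "z\<^sup>2 = w \<longleftrightarrow> z = csqrt w \<or> z = - csqrt w"
  by (metis power2_csqrt power2_eq_iff)

lemma monic_quadratic_root_iff_csqrt:
  "z\<^sup>2 + z + c = 0 \<longleftrightarrow> z = - (1/2) + csqrt (1 - 4 * c) / 2 \<or> z = - (1/2) - csqrt (1 - 4 * c) / 2"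
proof -
  have "(2 * z + 1)\<^sup>2 - (1 - 4 * c) = 4 * (z\<^sup>2 + z + c)"
    by (simp add: power2_eq_square algebra_simps)
  then have "z\<^sup>2 + z + c = 0 \<longleftrightarrow> (2 * z + 1)\<^sup>2 = 1 - 4 * c"
    by (metis eq_iff_diff_eq_0 mult_eq_0_iff zero_neq_numeral)
  also have "\<dots> \<longleftrightarrow> 2 * z + 1 = csqrt (1 - 4 * c) \<or> 2 * z + 1 = - csqrt (1 - 4 * c)"
    by (rule sq_eq_iff_csqrt)
  also have "\<dots> \<longleftrightarrow> z = - (1/2) + csqrt (1 - 4 * c) / 2 \<or> z = - (1/2) - csqrt (1 - 4 * c) / 2"
  proof -
    have "2 * z + 1 = s \<longleftrightarrow> z = - (1/2) + s / 2" for s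
      by (auto simp: field_simps)
    from this[of "csqrt (1 - 4 * c)"] this[of "- csqrt (1 - 4 * c)"] show ?thesis
      by simp
  qed
  finally show ?thesis .
qed

theorem proposition3p5:
  fixes G :: "nat pair_pre_digraph" and n d x y :: nat
    and l :: complex and v u :: "complex vec"
  assumes "pair_graph G"
    and "Digraph_Component.connected (with_proj G)"
    and "pverts G = {0..<n}"
    and "twins G x y"
    and "vdegree G x = d" and "vdegree G y = d"
    and "generalized_eigenpair (K_mat n G) l v u"
    and "l \<noteq> 0"
  shows "(nonadjacent_twins G x y \<longrightarrow>
           (l = csqrt (1 - of_nat d) \<or> l = - csqrt (1 - of_nat d) \<longrightarrow> v $ x = v $ y) \<and>
           (l \<notin> {csqrt (1 - of_nat d), - csqrt (1 - of_nat d)} \<longrightarrow> u $ x = u $ y)) \<and>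
         (adjacent_twins G x y \<longrightarrow>
           (l = - (1/2) + csqrt (5 - 4 * of_nat d) / 2 \<or>
            l = - (1/2) - csqrt (5 - 4 * of_nat d) / 2 \<longrightarrow> v $ x = v $ y) \<and>
           (l \<notin> {- (1/2) + csqrt (5 - 4 * of_nat d) / 2,
                  - (1/2) - csqrt (5 - 4 * of_nat d) / 2} \<longrightarrow> u $ x = u $ y))"
proof -
  define e :: complex where "e = (if (x, y) \<in> parcs G then - 1 else 0)"
  define c :: complex where "c = of_nat d - 1"
  have v: "v \<in> carrier_vec (n + n)" "K_mat n G *\<^sub>v v = l \<cdot>\<^sub>v v"
    and u: "u \<in> carrier_vec (n + n)" "K_mat n G *\<^sub>v u = l \<cdot>\<^sub>v u + v"
    using assms(7) by (auto simp: generalized_eigenpair_def eigenvector_def K_mat_def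
        adjacency_mat_def)
  have v': "K_mat n G *\<^sub>v v = l \<cdot>\<^sub>v v + 0\<^sub>v (n + n)"
    using v by simp
  have xy: "x < n" "y < n"
    using assms(3,4) by (auto simp: twins_def)
  note diff = K_mat_twin_differences[OF assms(1,3-6), folded e_def c_def]
  have chain: "e * (v $ x - v $ y) + c * (v $ (n + x) - v $ (n + y)) = l * (v $ x - v $ y)"
    "- (v $ x - v $ y) = l * (v $ (n + x) - v $ (n + y))"
    using diff[OF v(1) _ v'] xy by simp_all
  note chain = Jordan_chain_of_companion[OF chain diff[OF u(1) v(1) u(2)] \<open>l \<noteq> 0\<close>]
  show ?thesis
  proof (rule conjI; rule impI)
    assume "nonadjacent_twins G x y"
    then have e: "e = 0"
      by (simp add: e_def nonadjacent_twins_def)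
    have "l\<^sup>2 - e * l + c = 0 \<longleftrightarrow> l = csqrt (1 - of_nat d) \<or> l = - csqrt (1 - of_nat d)"
      unfolding sq_eq_iff_csqrt[symmetric] by (auto simp: e c_def algebra_simps)
    moreover have "2 * l \<noteq> e"
      using \<open>l \<noteq> 0\<close> e by simp
    ultimately show "(l = csqrt (1 - of_nat d) \<or> l = - csqrt (1 - of_nat d) \<longrightarrow> v $ x = v $ y) \<and>
        (l \<notin> {csqrt (1 - of_nat d), - csqrt (1 - of_nat d)} \<longrightarrow> u $ x = u $ y)"
      using chain by auto
  next
    assume "adjacent_twins G x y"
    then have e: "e = - 1"
      by (simp add: e_def adjacent_twins_def)
    have disc: "1 - 4 * c = 5 - 4 * of_nat d"
      by (simp add: c_def)
    have roots: "l\<^sup>2 - e * l + c = 0 \<longleftrightarrow>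
        l = - (1/2) + csqrt (5 - 4 * of_nat d) / 2 \<or> l = - (1/2) - csqrt (5 - 4 * of_nat d) / 2"
      using monic_quadratic_root_iff_csqrt[of l c] unfolding disc e by simp
    have "2 * l \<noteq> e" if root: "l\<^sup>2 - e * l + c = 0"
    proof
      assume "2 * l = e"
      then have "l = - (1/2)"
        by (simp add: e field_simps)
      then have "4 * (of_nat d :: complex) = 5"
        using root unfolding \<open>l = - (1/2)\<close> e c_def by (simp add: power2_eq_square field_simps)
      then have "of_nat (4 * d) = (of_nat 5 :: complex)"
        by simp
      then have "4 * d = 5"
        by (simp only: of_nat_eq_iff)
      then show False
        by presburger
    qed
    then show "(l = - (1/2) + csqrt (5 - 4 * of_nat d) / 2 \<or>
            l = - (1/2) - csqrt (5 - 4 * of_nat d) / 2 \<longrightarrow> v $ x = v $ y) \<and>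
        (l \<notin> {- (1/2) + csqrt (5 - 4 * of_nat d) / 2,
               - (1/2) - csqrt (5 - 4 * of_nat d) / 2} \<longrightarrow> u $ x = u $ y)"
      using chain roots by auto
  qed
qed

end
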